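(* Let $K$ be a finite extension of $\mathbb{Q}_2$ with ramification index $e$. For any pair of even integers $i,j\ge0$ with $i+j=2e$, one has $(U_i,U_j)_K=1$, i.e. $(a,b)_K=1$ for all $a\in U_i$ and $b\in U_j$.
   Context: $\mathfrak{o}$ is the ring of integers of $K$, $\pi$ a prime element, and $e$ is the largest integer with $\pi^e\mid2$. $U_0:=\mathfrak{o}^\times$ and $U_n:=1+\pi^n\mathfrak{o}$ for $n\ge1$. $(\cdot,\cdot)_K:K^\times\times K^\times\to\{\pm1\}$ is the quadratic Hilbert symbol of $K$: $(a,b)_K=1$ if and only if $ax^2+by^2=1$ has a solution $x,y\in K$. *)

theory Defs
  imports "HOL-Computational_Algebra.Polynomial_Factorial"
begin

text \<open>
  The ring of 2-adic integers is the inverse limit of the rings of integers modulo \<open>2 ^ n\<close>;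
  residues are represented by integers in \<open>{0..<2 ^ n}\<close>. The range condition
  follows from the compatibility condition.
\<close>

typedef two_adic_int = "{x :: nat \<Rightarrow> int. \<forall>n. x n = x (Suc n) mod 2 ^ n}"
  morphisms residue Abs_two_adic_int
  by (rule exI[of _ "\<lambda>_. 0"]) simp

setup_lifting type_definition_two_adic_int

lemma mod_pow2_Suc_mod: "(a mod 2 ^ Suc n) mod 2 ^ n = a mod (2 ^ n :: int)"
  by (rule mod_mod_cancel) (simp add: le_imp_power_dvd)

lemma residue_Suc_mod: "residue x (Suc n) mod 2 ^ n = residue x n"
  using residue[of x] by (metis (mono_tags, lifting) mem_Collect_eq)

lemma residue_mod: "n \<le> m \<Longrightarrow> residue x m mod 2 ^ n = residue x n"
proof (induction m rule: dec_induct)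
  case base
  show ?case by (metis residue_Suc_mod mod_mod_trivial)
next
  case (step m)
  have "residue x (Suc m) mod 2 ^ n = residue x (Suc m) mod 2 ^ m mod 2 ^ n"
    using step.hyps by (simp add: mod_mod_cancel le_imp_power_dvd)
  then show ?case by (simp add: residue_Suc_mod step.IH)
qed

lemma residue_mod_self: "residue x n mod 2 ^ n = residue x n"
  by (rule residue_mod) simp

lemma residue_0: "residue x 0 = 0"
  using residue_mod_self[of x 0] by simp

lemma two_adic_int_eqI: "(\<And>n. residue x n = residue y n) \<Longrightarrow> x = y"
  by (simp add: residue_inject[symmetric] fun_eq_iff)

lemma compatible_mod_pow2:
  fixes f :: "int \<Rightarrow> int \<Rightarrow> int"
  assumes f: "\<And>a b m. f (a mod m) (b mod m) mod m = f a b mod m"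
    and x: "\<And>n. x n = x (Suc n) mod 2 ^ n" and y: "\<And>n. y n = y (Suc n) mod 2 ^ n"
  shows "f (x n) (y n) mod 2 ^ n = f (x (Suc n)) (y (Suc n)) mod 2 ^ Suc n mod 2 ^ n"
  unfolding mod_pow2_Suc_mod by (subst x, subst y, rule f)

instantiation two_adic_int :: comm_ring_1
begin

lift_definition zero_two_adic_int :: two_adic_int is "\<lambda>_. 0" by simp

lift_definition one_two_adic_int :: two_adic_int is "\<lambda>n. 1 mod 2 ^ n"
  by (simp only: mod_pow2_Suc_mod simp_thms)

lift_definition plus_two_adic_int :: "two_adic_int \<Rightarrow> two_adic_int \<Rightarrow> two_adic_int"
  is "\<lambda>x y n. (x n + y n) mod 2 ^ n"
  by (intro allI compatible_mod_pow2[of "(+)"]) (blast intro: mod_add_eq)+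

lift_definition times_two_adic_int :: "two_adic_int \<Rightarrow> two_adic_int \<Rightarrow> two_adic_int"
  is "\<lambda>x y n. (x n * y n) mod 2 ^ n"
  by (intro allI compatible_mod_pow2[of "(*)"]) (blast intro: mod_mult_eq)+

lift_definition minus_two_adic_int :: "two_adic_int \<Rightarrow> two_adic_int \<Rightarrow> two_adic_int"
  is "\<lambda>x y n. (x n - y n) mod 2 ^ n"
  by (intro allI compatible_mod_pow2[of "(-)"]) (blast intro: mod_diff_eq)+

lift_definition uminus_two_adic_int :: "two_adic_int \<Rightarrow> two_adic_int"
  is "\<lambda>x n. (- x n) mod 2 ^ n"
  by (intro allI compatible_mod_pow2[of "\<lambda>a _. - a"]) (blast intro: mod_minus_eq)+

lemmas residue_simps =
  zero_two_adic_int.rep_eq one_two_adic_int.rep_eq plus_two_adic_int.rep_eq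
  times_two_adic_int.rep_eq minus_two_adic_int.rep_eq uminus_two_adic_int.rep_eq

instance
proof
  fix a b c :: two_adic_int
  show "a * b * c = a * (b * c)"
    by (rule two_adic_int_eqI) (simp add: residue_simps mod_simps mult.assoc)
  show "a * b = b * a"
    by (rule two_adic_int_eqI) (simp add: residue_simps mult.commute)
  show "1 * a = a"
    by (rule two_adic_int_eqI) (simp add: residue_simps mod_simps residue_mod_self residue_0)
  show "a + b + c = a + (b + c)"
    by (rule two_adic_int_eqI) (simp add: residue_simps mod_simps add.assoc)
  show "a + b = b + a"
    by (rule two_adic_int_eqI) (simp add: residue_simps add.commute)
  show "0 + a = a"
    by (rule two_adic_int_eqI) (simp add: residue_simps residue_mod_self)
  show "- a + a = 0"
    by (rule two_adic_int_eqI) (simp add: residue_simps mod_simps)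
  show "a - b = a + - b"
    by (rule two_adic_int_eqI) (simp add: residue_simps mod_simps)
  show "(a + b) * c = a * c + b * c"
    by (rule two_adic_int_eqI) (simp add: residue_simps mod_simps distrib_right)
  have "residue 0 1 \<noteq> residue 1 1"
    by (simp add: residue_simps)
  then show "(0 :: two_adic_int) \<noteq> 1"
    by metis
qed

end

instance two_adic_int :: idom
proof
  fix a b :: two_adic_int
  assume "a \<noteq> 0" "b \<noteq> 0"
  then obtain m n where m: "residue a m \<noteq> 0" and n: "residue b n \<noteq> 0"
    by (metis two_adic_int_eqI zero_two_adic_int.rep_eq)
  have "\<not> 2 ^ m dvd residue a (m + n)"
    using m residue_mod[of m "m + n" a] by (simp add: dvd_eq_mod_eq_0)
  then have m': "multiplicity 2 (residue a (m + n)) < m"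
    by (metis not_less multiplicity_dvd')
  have "\<not> 2 ^ n dvd residue b (m + n)"
    using n residue_mod[of n "m + n" b] by (simp add: dvd_eq_mod_eq_0)
  then have n': "multiplicity 2 (residue b (m + n)) < n"
    by (metis not_less multiplicity_dvd')
  have nz: "residue a (m + n) \<noteq> 0" "residue b (m + n) \<noteq> 0"
    using \<open>\<not> 2 ^ m dvd _\<close> \<open>\<not> 2 ^ n dvd _\<close> by auto
  have "multiplicity 2 (residue a (m + n) * residue b (m + n))
      = multiplicity 2 (residue a (m + n)) + multiplicity 2 (residue b (m + n))"
    using nz by (intro prime_elem_multiplicity_mult_distrib) auto
  then have "\<not> 2 ^ (m + n) dvd residue a (m + n) * residue b (m + n)"
    using m' n' nz by (simp add: power_dvd_iff_le_multiplicity)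
  then have "residue (a * b) (m + n) \<noteq> 0"
    by (simp add: times_two_adic_int.rep_eq dvd_eq_mod_eq_0)
  then show "a * b \<noteq> 0"
    by (metis zero_two_adic_int.rep_eq)
qed

type_synonym two_adic = "two_adic_int fract"

text \<open>
  A finite extension of a field \<open>F\<close> is a field together with a map \<open>\<iota>\<close> from \<open>F\<close>
  that makes it a finite-dimensional \<open>F\<close>-vector space under \<open>(c, x) \<mapsto> \<iota> c * x\<close>. The
  vector space axioms say precisely that \<open>\<iota>\<close> is a ring homomorphism.
\<close>

definition finite_field_extension :: "('a :: field \<Rightarrow> 'b :: field) \<Rightarrow> bool" where
  "finite_field_extension \<iota> \<longleftrightarrow> (\<exists>B. finite_dimensional_vector_space (\<lambda>c x. \<iota> c * x) B)"

lemma finite_field_extension_hom: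
  assumes "finite_field_extension \<iota>"
  shows "\<iota> (a + b) = \<iota> a + \<iota> b" "\<iota> (a * b) = \<iota> a * \<iota> b" "\<iota> 1 = 1"
proof -
  obtain B where "finite_dimensional_vector_space (\<lambda>c x. \<iota> c * x) B"
    using assms by (auto simp: finite_field_extension_def)
  then interpret finite_dimensional_vector_space "\<lambda>c x. \<iota> c * x" B .
  show "\<iota> (a + b) = \<iota> a + \<iota> b" using scale_left_distrib[of a b 1] by simp
  show "\<iota> (a * b) = \<iota> a * \<iota> b" using scale_scale[of a b 1] by simp
  show "\<iota> 1 = 1" using scale_one[of 1] by simp
qed

text \<open>The ring of integers is the integral closure of the 2-adic integers in the extension.\<close>

definition ring_of_integers :: "(two_adic \<Rightarrow> 'k :: field) \<Rightarrow> 'k set" where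
  "ring_of_integers \<iota> =
     {x. \<exists>p :: two_adic_int poly. lead_coeff p = 1 \<and> poly (map_poly (\<lambda>a. \<iota> (to_fract a)) p) x = 0}"

text \<open>
  The type-class notions of divisibility, unit and prime element would refer to the whole field,
  so they are stated relative to a subring \<open>R\<close>.
\<close>

definition dvd_in :: "'k :: field set \<Rightarrow> 'k \<Rightarrow> 'k \<Rightarrow> bool" where
  "dvd_in R a b \<longleftrightarrow> (\<exists>c\<in>R. b = a * c)"

definition units_in :: "'k :: field set \<Rightarrow> 'k set" where
  "units_in R = {u \<in> R. dvd_in R u 1}"

definition prime_elem_in :: "'k :: field set \<Rightarrow> 'k \<Rightarrow> bool" where
  "prime_elem_in R p \<longleftrightarrow> p \<in> R \<and> p \<noteq> 0 \<and> p \<notin> units_in R \<and>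
     (\<forall>a\<in>R. \<forall>b\<in>R. dvd_in R p (a * b) \<longrightarrow> dvd_in R p a \<or> dvd_in R p b)"

definition ramification_index :: "(two_adic \<Rightarrow> 'k :: field) \<Rightarrow> 'k \<Rightarrow> nat" where
  "ramification_index \<iota> \<pi> = (GREATEST n. dvd_in (ring_of_integers \<iota>) (\<pi> ^ n) 2)"

definition unit_group :: "(two_adic \<Rightarrow> 'k :: field) \<Rightarrow> 'k \<Rightarrow> nat \<Rightarrow> 'k set" where
  "unit_group \<iota> \<pi> n =
     (if n = 0 then units_in (ring_of_integers \<iota>)
      else {1 + \<pi> ^ n * x | x. x \<in> ring_of_integers \<iota>})"

definition hilbert_symbol :: "'k :: field \<Rightarrow> 'k \<Rightarrow> int" where
  "hilbert_symbol a b = (if \<exists>x y. a * x\<^sup>2 + b * y\<^sup>2 = 1 then 1 else -1)"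

end

theory Submission
  imports Defs "Jordan_Normal_Form.Char_Poly"
begin

text \<open>
  Write \<open>i = 2 * s\<close>, \<open>j = 2 * t\<close>, \<open>a = 1 + \<pi> ^ (2 * s) * \<alpha>\<close>, \<open>b = 1 + \<pi> ^ (2 * t) * \<beta>\<close> and
  \<open>2 = \<pi> ^ (s + t) * \<epsilon>\<close>, and assume \<open>t > 0\<close> by symmetry. Substituting \<open>x = 1 / \<pi> ^ s\<close>,
  \<open>y = Y / \<pi> ^ t\<close> and \<open>z = x + y + w\<close> turns \<open>a * x\<^sup>2 + b * y\<^sup>2 = z\<^sup>2\<close> into the equation
  \<open>\<beta> * Y\<^sup>2 - \<epsilon> * (1 + \<pi> ^ s * w) * Y + (\<alpha> - w\<^sup>2 - \<epsilon> * \<pi> ^ t * w) = 0\<close> over the ring of integers. As the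
  residue field is perfect, \<open>w\<close> can be chosen with \<open>w\<^sup>2 \<equiv> \<alpha>\<close> modulo \<open>\<pi>\<close>; then the constant
  coefficient is divisible by \<open>\<pi>\<close>, while the linear one is a unit because
  \<open>(1 + \<pi> ^ s * w)\<^sup>2 \<equiv> a\<close>. So Hensel's lemma gives a root \<open>Y\<close>.

  Hensel's lemma and the fact that nonunits are divisible by \<open>\<pi>\<close> are derived from the 2-adic
  completeness of subrings that are finitely generated modules over the 2-adic integers. This
  avoids showing that the ring of integers itself is finitely generated.
\<close>

section \<open>Completeness of the 2-adic integers\<close>

lemma residue_of_int: "residue (of_int n) k = n mod 2 ^ k"
proof -
  have nat: "residue (of_nat m) k = int m mod 2 ^ k" for m
    by (induction m) (simp_all add: residue_simps mod_simps algebra_simps)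
  show ?thesis
    by (cases n) (simp_all add: nat residue_simps mod_simps del: of_nat_Suc)
qed

lemma pow2_dvd_two_adic_int_iff: "2 ^ n dvd (z :: two_adic_int) \<longleftrightarrow> residue z n = 0"
proof -
  have r: "residue (2 ^ n) m = 2 ^ n mod 2 ^ m" for m
    using residue_of_int[of "2 ^ n" m] by simp
  show ?thesis
  proof
    assume "2 ^ n dvd z"
    then show "residue z n = 0"
      by (auto simp: dvd_def residue_simps r)
  next
    assume z: "residue z n = 0"
    \<comment> \<open>Division by \<open>2 ^ n\<close> costs \<open>n\<close> digits, so the
      quotient modulo \<open>2 ^ m\<close> is read off from \<open>z\<close> modulo
      \<open>2 ^ (m + n)\<close>.\<close>
    define c where "c = (\<lambda>m. residue z (m + n) div 2 ^ n)"
    have dvd: "2 ^ n dvd residue z (m + n)" for m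
      using residue_mod[of n "m + n" z] z by (simp add: dvd_eq_mod_eq_0)
    have c: "2 ^ n * c m = residue z (m + n)" for m
      using dvd by (simp add: c_def)
    have "c m = c (Suc m) mod 2 ^ m" for m
    proof -
      have "2 ^ n * (c (Suc m) mod 2 ^ m) = (2 ^ n * c (Suc m)) mod (2 ^ n * 2 ^ m)"
        by (rule mult_mod_right)
      also have "\<dots> = residue z (m + n)"
        using residue_Suc_mod[of z "m + n"] c[of "Suc m"] by (simp add: power_add mult.commute)
      also have "\<dots> = 2 ^ n * c m"
        by (simp only: c)
      finally show ?thesis
        by (metis mult_left_cancel power_not_zero zero_neq_numeral)
    qed
    then have res: "residue (Abs_two_adic_int c) m = c m" for m
      by (subst Abs_two_adic_int_inverse) (blast intro: refl)+
    have "z = 2 ^ n * Abs_two_adic_int c"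
    proof (rule two_adic_int_eqI)
      fix m
      have "residue (2 ^ n * Abs_two_adic_int c) m = residue z (m + n) mod 2 ^ m"
        by (simp add: residue_simps res r c mod_simps)
      then show "residue z m = residue (2 ^ n * Abs_two_adic_int c) m"
        by (simp add: residue_mod)
    qed
    then show "2 ^ n dvd z"
      by simp
  qed
qed

lemma two_adic_int_separated:
  assumes "\<And>n. 2 ^ n dvd (z :: two_adic_int)"
  shows "z = 0"
  using assms by (intro two_adic_int_eqI) (simp add: pow2_dvd_two_adic_int_iff residue_simps)

lemma two_neq_0_two_adic_int: "(2 :: two_adic_int) \<noteq> 0"
proof
  assume "(2 :: two_adic_int) = 0"
  then have "residue (of_int 2) 2 = residue (0 :: two_adic_int) 2"
    by simp
  then show False
    unfolding residue_of_int by (simp add: residue_simps)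
qed

text \<open>Modulo \<open>2 ^ n\<close> only the first \<open>n\<close> terms count, so the residues
  of the partial sums are compatible and define the limit.\<close>

lemma two_adic_series_converges:
  fixes a :: "nat \<Rightarrow> two_adic_int"
  obtains A where "\<And>n. 2 ^ n dvd A - (\<Sum>i<n. 2 ^ i * a i)"
proof -
  define f where "f = (\<lambda>n. residue (\<Sum>i<n. 2 ^ i * a i) n)"
  have "f n = f (Suc n) mod 2 ^ n" for n
  proof -
    have "residue (\<Sum>i<Suc n. 2 ^ i * a i) (Suc n) mod 2 ^ n = residue (\<Sum>i<Suc n. 2 ^ i * a i) n"
      by (rule residue_Suc_mod)
    moreover have "residue (2 ^ n * a n) n = 0"
      using pow2_dvd_two_adic_int_iff[of n "2 ^ n * a n"] by simp
    ultimately show ?thesis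
      by (simp add: f_def residue_simps residue_mod_self)
  qed
  then have "residue (Abs_two_adic_int f) n = f n" for n
    by (subst Abs_two_adic_int_inverse) (blast intro: refl)+
  then show thesis
    by (intro that[of "Abs_two_adic_int f"])
      (simp add: pow2_dvd_two_adic_int_iff residue_simps f_def)
qed

section \<open>Divisibility in subrings of a field\<close>

text \<open>Divisibility has to be compared in several subrings of one field, so its rules are
  proved for an arbitrary carrier set.\<close>

locale field_subring =
  fixes R :: "'k :: field set"
  assumes one_closed: "1 \<in> R"
    and diff_closed: "x \<in> R \<Longrightarrow> y \<in> R \<Longrightarrow> x - y \<in> R"
    and mult_closed: "x \<in> R \<Longrightarrow> y \<in> R \<Longrightarrow> x * y \<in> R"
begin

lemma zero_closed: "0 \<in> R"
  using diff_closed[OF one_closed one_closed] by simp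

lemma uminus_closed: "x \<in> R \<Longrightarrow> - x \<in> R"
  using diff_closed[OF zero_closed, of x] by simp

lemma add_closed: "x \<in> R \<Longrightarrow> y \<in> R \<Longrightarrow> x + y \<in> R"
  using diff_closed[of x "- y"] uminus_closed[of y] by simp

lemma power_closed: "x \<in> R \<Longrightarrow> x ^ n \<in> R"
  by (induction n) (auto intro: one_closed mult_closed)

lemma numeral_closed: "numeral n \<in> R"
proof -
  have "of_nat m \<in> R" for m
    by (induction m) (auto intro: zero_closed one_closed add_closed)
  from this[of "numeral n"] show ?thesis by simp
qed

lemmas closed = one_closed zero_closed diff_closed mult_closed uminus_closed add_closed
  power_closed numeral_closed

lemma dvd_in_0: "dvd_in R a 0"
  using zero_closed by (auto simp: dvd_in_def)

lemma dvd_in_triv: "c \<in> R \<Longrightarrow> dvd_in R a (a * c)"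
  by (auto simp: dvd_in_def)

lemma dvd_in_refl: "dvd_in R a a"
  using dvd_in_triv[OF one_closed, of a] by simp

lemma dvd_in_add: "dvd_in R a b \<Longrightarrow> dvd_in R a c \<Longrightarrow> dvd_in R a (b + c)"
  unfolding dvd_in_def by (metis add_closed distrib_left)

lemma dvd_in_diff: "dvd_in R a b \<Longrightarrow> dvd_in R a c \<Longrightarrow> dvd_in R a (b - c)"
  unfolding dvd_in_def by (metis diff_closed right_diff_distrib)

lemma dvd_in_mult: "dvd_in R a b \<Longrightarrow> c \<in> R \<Longrightarrow> dvd_in R a (b * c)"
  unfolding dvd_in_def by (metis mult_closed mult.assoc)

lemma dvd_in_mult_left: "dvd_in R a b \<Longrightarrow> c \<in> R \<Longrightarrow> dvd_in R a (c * b)"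
  using dvd_in_mult[of a b c] by (simp add: mult.commute)

lemma dvd_in_trans: "dvd_in R a b \<Longrightarrow> dvd_in R b c \<Longrightarrow> dvd_in R a c"
  unfolding dvd_in_def by (metis mult_closed mult.assoc)

lemma dvd_in_power: "dvd_in R a b \<Longrightarrow> dvd_in R (a ^ n) (b ^ n)"
  unfolding dvd_in_def by (metis power_closed power_mult_distrib)

lemma units_in_iff: "u \<in> units_in R \<longleftrightarrow> u \<in> R \<and> u \<noteq> 0 \<and> inverse u \<in> R"
proof
  assume "u \<in> units_in R"
  then obtain c where "u \<in> R" "c \<in> R" "1 = u * c"
    by (auto simp: units_in_def dvd_in_def)
  then show "u \<in> R \<and> u \<noteq> 0 \<and> inverse u \<in> R"
    by (metis inverse_unique mult_zero_left zero_neq_one)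
next
  assume "u \<in> R \<and> u \<noteq> 0 \<and> inverse u \<in> R"
  then show "u \<in> units_in R"
    by (auto simp: units_in_def dvd_in_def intro!: bexI[of _ "inverse u"])
qed

end

section \<open>Finitely generated subrings of the extension\<close>

locale two_adic_extension =
  fixes \<iota> :: "two_adic \<Rightarrow> 'k :: field"
  assumes finite_extension: "finite_field_extension \<iota>"
begin

definition emb :: "two_adic_int \<Rightarrow> 'k" where
  "emb a = \<iota> (to_fract a)"

lemma emb_conv: "emb = (\<lambda>a. \<iota> (to_fract a))"
  by (simp add: emb_def fun_eq_iff)

lemmas \<iota>_hom = finite_field_extension_hom[OF finite_extension]

lemma \<iota>_0: "\<iota> 0 = 0"
  using \<iota>_hom(1)[of 0 0] by (simp only: add_0_left add_cancel_right_right)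

lemma \<iota>_eq_0_iff: "\<iota> a = 0 \<longleftrightarrow> a = 0"
proof
  assume "\<iota> a = 0"
  then have "\<iota> (a * inverse a) = 0"
    unfolding \<iota>_hom(2) by simp
  then show "a = 0"
    using \<iota>_hom(3) by (cases "a = 0") auto
qed (simp add: \<iota>_0)

sublocale emb: inj_comm_ring_hom emb
  by unfold_locales (auto simp: emb_def \<iota>_hom \<iota>_eq_0_iff)

sublocale M: Modules.module "\<lambda>a x. emb a * x"
  by unfold_locales (auto simp: emb.hom_add emb.hom_mult algebra_simps)

text \<open>Additive closure comes with the span, so only \<open>1\<close> and products are
  demanded. Every integral element will turn out to lie in such a ring, and the ring inherits
  completeness from its coefficients.\<close>

definition finite_subring :: "'k set \<Rightarrow> bool" where
  "finite_subring S \<longleftrightarrow>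
     (\<exists>G. finite G \<and> S = M.span G) \<and> 1 \<in> S \<and> (\<forall>x\<in>S. \<forall>y\<in>S. x * y \<in> S)"

lemma finite_subringE:
  assumes "finite_subring S"
  obtains G where "finite G" "S = M.span G"
  using assms by (auto simp: finite_subring_def)

lemma finite_subring_field_subring:
  assumes "finite_subring S"
  shows "field_subring S"
proof -
  have "M.subspace S"
    using assms by (auto simp: finite_subring_def)
  then show ?thesis
    using assms M.subspace_diff[of S] by unfold_locales (auto simp: finite_subring_def)
qed

text \<open>The determinant trick: the generators form an eigenvector, with eigenvalue \<open>x\<close>, of the
  matrix of multiplication by \<open>x\<close>.\<close>
lemma finite_subring_integral:
  assumes S: "finite_subring S" and x: "x \<in> S"
  shows "x \<in> ring_of_integers \<iota>"
proof -
  interpret S: field_subring S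
    using S by (rule finite_subring_field_subring)
  obtain G where G: "finite G" "S = M.span G"
    using S by (rule finite_subringE)
  obtain gs where gs: "set gs = G" "distinct gs"
    using G(1) finite_distinct_list by blast
  define n where "n = length gs"
  have "\<exists>u. x * g = (\<Sum>k\<in>G. emb (u k) * k)" if "g \<in> G" for g
  proof -
    have "g \<in> S" using that G(2) by (simp add: M.span_base)
    then have "x * g \<in> M.span G" using x G(2) S.mult_closed by blast
    then show ?thesis unfolding M.span_finite[OF G(1)] by auto
  qed
  then obtain u where u: "\<And>g. g \<in> G \<Longrightarrow> x * g = (\<Sum>k\<in>G. emb (u g k) * k)"
    by metis
  define A where "A = mat n n (\<lambda>(i, j). u (gs ! i) (gs ! j))"
  define v where "v = vec n (\<lambda>i. gs ! i)"
  have A: "A \<in> carrier_mat n n" "map_mat emb A \<in> carrier_mat n n"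
    by (auto simp: A_def)
  \<comment> \<open>An eigenvector must be nonzero: if all generators vanished, their span could not
    contain \<open>1\<close>.\<close>
  have "v \<noteq> 0\<^sub>v n"
  proof
    assume "v = 0\<^sub>v n"
    then have "gs ! i = 0" if "i < n" for i
      using that by (metis index_vec index_zero_vec(1) v_def)
    then have "G \<subseteq> {0}"
      unfolding gs(1)[symmetric] n_def by (auto simp: in_set_conv_nth)
    then have "M.span G \<subseteq> {0}"
      by (intro M.span_minimal) (auto simp: M.subspace_def)
    then show False
      using S.one_closed G(2) by auto
  qed
  moreover have "map_mat emb A *\<^sub>v v = x \<cdot>\<^sub>v v"
  proof (rule eq_vecI)
    fix i assume "i < dim_vec (x \<cdot>\<^sub>v v)"
    then have i: "i < n" by (simp add: v_def)
    have "(map_mat emb A *\<^sub>v v) $ i = (\<Sum>j = 0..<n. emb (u (gs ! i) (gs ! j)) * gs ! j)"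
      using i by (simp add: A_def v_def scalar_prod_def)
    also have "\<dots> = (\<Sum>k\<in>G. emb (u (gs ! i) k) * k)"
      using sum.reindex_bij_betw[OF bij_betw_nth[OF gs(2) refl gs(1)[symmetric]],
          of "\<lambda>k. emb (u (gs ! i) k) * k"]
      by (simp only: atLeast0LessThan n_def)
    also have "\<dots> = x * gs ! i"
      using u[of "gs ! i"] i gs(1) nth_mem[of i gs] by (metis n_def)
    finally show "(map_mat emb A *\<^sub>v v) $ i = (x \<cdot>\<^sub>v v) $ i"
      using i by (simp add: v_def)
  qed (simp add: A_def v_def)
  ultimately have "eigenvector (map_mat emb A) v x"
    by (simp add: eigenvector_def A_def v_def)
  then have "poly (char_poly (map_mat emb A)) x = 0"
    using eigenvalue_root_char_poly[OF A(2)] by (auto simp: eigenvalue_def)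
  \<comment> \<open>The matrix has 2-adic integer entries, so its characteristic polynomial is a
    monic integral equation for \<open>x\<close>.\<close>
  then have "poly (map_poly emb (char_poly A)) x = 0"
    by (simp add: emb.char_poly_hom[OF A(1)])
  moreover have "lead_coeff (char_poly A) = 1"
    using degree_monic_char_poly[OF A(1)] by simp
  ultimately show ?thesis
    unfolding ring_of_integers_def emb_conv by auto
qed

lemma finite_subring_range: "finite_subring (range emb)"
  unfolding finite_subring_def
proof (intro conjI exI ballI)
  show "range emb = M.span {1}"
    by (subst M.span_finite) (auto simp: fun_eq_iff intro!: image_eqI)
  show "1 \<in> range emb"
    by (metis emb.hom_one rangeI)
  show "x * y \<in> range emb" if "x \<in> range emb" "y \<in> range emb" for x y
    using that by (auto simp flip: emb.hom_mult)
qed simp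

text \<open>The monic equation of \<open>x\<close> lowers high powers, so the products of generators
  of \<open>S\<close> with the powers of \<open>x\<close> below its degree span a ring.\<close>

lemma finite_subring_adjoin:
  assumes S: "finite_subring S" and x: "x \<in> ring_of_integers \<iota>"
  obtains S' where "finite_subring S'" "S \<subseteq> S'" "x \<in> S'"
proof -
  interpret S: field_subring S
    using S by (rule finite_subring_field_subring)
  obtain G where G: "finite G" "S = M.span G"
    using S by (rule finite_subringE)
  obtain p where p: "lead_coeff p = 1" "poly (map_poly emb p) x = 0"
    using x by (auto simp: ring_of_integers_def emb_conv)
  define n where "n = degree p"
  have "poly (map_poly emb p) x = (\<Sum>i\<le>n. emb (coeff p i) * x ^ i)"
    by (simp add: poly_altdef n_def coeff_map_poly)
  also have "\<dots> = (\<Sum>i<n. emb (coeff p i) * x ^ i) + x ^ n"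
    using p(1) by (simp add: n_def flip: lessThan_Suc_atMost)
  finally have xn: "x ^ n = - (\<Sum>i<n. emb (coeff p i) * x ^ i)"
    using p(2) by (simp add: add_eq_0_iff)
  define H where "H = (\<lambda>(g, i). g * x ^ i) ` (G \<times> {..<n})"
  define T where "T = M.span H"
  have T: "M.subspace T" by (simp add: T_def)
  have low: "s * x ^ i \<in> T" if "s \<in> S" "i < n" for s i
  proof -
    have "M.span G \<subseteq> {s. s * x ^ i \<in> T}"
    proof (rule M.span_minimal)
      show "G \<subseteq> {s. s * x ^ i \<in> T}"
        using that by (auto simp: T_def H_def intro!: M.span_base)
      show "M.subspace {s. s * x ^ i \<in> T}"
        using T by (auto simp: M.subspace_def distrib_right mult.assoc)
    qed
    then show ?thesis using that G by auto
  qed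
  \<comment> \<open>Strong induction on the exponent: from \<open>n\<close> on, \<open>xn\<close>
    trades a power for lower ones.\<close>
  have pow: "s * x ^ i \<in> T" if "s \<in> S" for s i
    using that
  proof (induction i arbitrary: s rule: less_induct)
    case (less i)
    show ?case
    proof (cases "i < n")
      case False
      then have "x ^ i = x ^ (i - n) * x ^ n"
        by (simp flip: power_add)
      then have "s * x ^ i = - (\<Sum>k<n. emb (coeff p k) * (s * x ^ (i - n + k)))"
        by (simp add: xn sum_distrib_left power_add mult_ac)
      also have "\<dots> \<in> T"
        using less False
        by (intro M.subspace_neg[OF T] M.subspace_sum[OF T] M.subspace_scale[OF T]) auto
      finally show ?thesis .
    qed (use low less.prems in auto)
  qed
  have "finite_subring T"
    unfolding finite_subring_def
  proof (intro conjI exI ballI)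
    show "finite H" using G(1) by (simp add: H_def)
    show "T = M.span H" by (simp add: T_def)
    show "1 \<in> T" using pow[of 1 0] S.one_closed by simp
    fix y z assume y: "y \<in> T" and z: "z \<in> T"
    have GS: "g \<in> S" if "g \<in> G" for g
      using that by (simp add: G(2) M.span_base)
    \<comment> \<open>Closure under products is checked on generators and extended to the span one
      factor at a time.\<close>
    have HT: "h * z \<in> T" if h: "h \<in> H" for h
    proof -
      have "M.span H \<subseteq> {z. h * z \<in> T}"
      proof (rule M.span_minimal)
        show "H \<subseteq> {z. h * z \<in> T}"
        proof safe
          fix h' assume "h' \<in> H"
          then obtain g i g' i' where "h = g * x ^ i" "h' = g' * x ^ i'" "g \<in> G" "g' \<in> G"
            using h by (auto simp: H_def)
          then show "h * h' \<in> T"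
            using pow[of "g * g'" "i + i'"] S.mult_closed[OF GS GS, of g g']
            by (simp add: power_add mult_ac)
        qed
        show "M.subspace {z. h * z \<in> T}"
          using T by (auto simp: M.subspace_def distrib_left mult.left_commute[of h])
      qed
      then show ?thesis using z by (auto simp: T_def)
    qed
    have "M.span H \<subseteq> {y. y * z \<in> T}"
      using HT T by (intro M.span_minimal) (auto simp: M.subspace_def distrib_right mult.assoc)
    then show "y * z \<in> T" using y by (auto simp: T_def)
  qed
  moreover have "S \<subseteq> T" using pow[of _ 0] by auto
  moreover have "x \<in> T" using pow[of 1 1] S.one_closed by simp
  ultimately show thesis by (rule that)
qed

section \<open>2-adic separation and completeness of finitely generated subrings\<close>

lemma emb_power_2: "emb (2 ^ n) = 2 ^ n"
  by (simp add: emb.hom_power emb.hom_numeral)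

text \<open>The coordinates of the elements of a finitely generated submodule with respect to a basis of
  the extension have a common denominator \<open>d\<close>.\<close>
lemma finite_subring_separated:
  assumes S: "finite_subring S" and x: "\<And>n. dvd_in S (2 ^ n) x"
  shows "x = 0"
proof -
  obtain B where "finite_dimensional_vector_space (\<lambda>c x. \<iota> c * x) B"
    using finite_extension by (auto simp: finite_field_extension_def)
  then interpret V: finite_dimensional_vector_space "\<lambda>c x. \<iota> c * x" B .
  obtain G where G: "finite G" "S = M.span G"
    using S by (rule finite_subringE)
  have "V.representation B x b = 0" for b
  proof -
    let ?c = "\<lambda>x. V.representation B x b"
    have c_add: "?c (x + y) = ?c x + ?c y" and c_scale: "?c (\<iota> a * x) = a * ?c x" for a x y
      by (simp_all add: V.representation_add V.representation_scale V.independent_Basis V.span_Basis)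
    have "\<exists>d z. d \<noteq> 0 \<and> to_fract d * q = to_fract z" for q :: two_adic
    proof (cases q)
      case (Fract a b)
      then show ?thesis
        by (intro exI[of _ b] exI[of _ a]) (simp add: Fract_conv_to_fract)
    qed
    then obtain d z :: "two_adic \<Rightarrow> two_adic_int"
      where d: "\<And>q. d q \<noteq> 0" "\<And>q. to_fract (d q) * q = to_fract (z q)"
      by metis
    \<comment> \<open>The product of one denominator per generator clears the
      \<open>b\<close>-coordinate on all of \<open>S\<close>.\<close>
    define D where "D = (\<Prod>g\<in>G. d (?c g))"
    have D: "D \<noteq> 0" using G(1) d(1) by (simp add: D_def)
    have "M.span G \<subseteq> {s. \<exists>z. to_fract D * ?c s = to_fract z}"
    proof (rule M.span_minimal)
      show "G \<subseteq> {s. \<exists>z. to_fract D * ?c s = to_fract z}"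
      proof safe
        fix g assume "g \<in> G"
        then have "D = (\<Prod>g\<in>G - {g}. d (?c g)) * d (?c g)"
          using G(1) by (simp add: D_def prod.remove mult.commute)
        then have "to_fract D * ?c g = to_fract ((\<Prod>g\<in>G - {g}. d (?c g)) * z (?c g))"
          by (simp add: d(2) mult.assoc)
        then show "\<exists>z. to_fract D * ?c g = to_fract z" ..
      qed
      show "M.subspace {s. \<exists>z. to_fract D * ?c s = to_fract z}"
        unfolding M.subspace_def
      proof (intro conjI ballI allI)
        show "0 \<in> {s. \<exists>z. to_fract D * ?c s = to_fract z}"
          by (auto simp: V.representation_zero intro: exI[of _ 0])
      next
        fix x y
        assume "x \<in> {s. \<exists>z. to_fract D * ?c s = to_fract z}"
          "y \<in> {s. \<exists>z. to_fract D * ?c s = to_fract z}"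
        then show "x + y \<in> {s. \<exists>z. to_fract D * ?c s = to_fract z}"
          by (auto simp: c_add distrib_left simp flip: to_fract_add)
      next
        fix a x
        assume "x \<in> {s. \<exists>z. to_fract D * ?c s = to_fract z}"
        then show "emb a * x \<in> {s. \<exists>z. to_fract D * ?c s = to_fract z}"
          by (auto simp: emb_def c_scale mult.left_commute[of _ "to_fract a"] simp flip: to_fract_mult)
      qed
    qed
    then have int: "\<exists>z. to_fract D * ?c s = to_fract z" if "s \<in> S" for s
      using that G(2) by auto
    have "\<exists>w. to_fract D * ?c x = to_fract (2 ^ n * w)" for n
    proof -
      obtain s where s: "s \<in> S" "x = 2 ^ n * s"
        using x[of n] by (auto simp: dvd_in_def)
      then have "x = \<iota> (to_fract (2 ^ n)) * s"
        using emb_power_2 by (simp add: emb_def)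
      then have "to_fract D * ?c x = to_fract (2 ^ n) * (to_fract D * ?c s)"
        by (simp only: c_scale mult.left_commute)
      moreover obtain z where "to_fract D * ?c s = to_fract z"
        using int[OF s(1)] by blast
      ultimately show ?thesis
        by (metis to_fract_mult)
    qed
    then obtain w where w: "\<And>n. to_fract D * ?c x = to_fract (2 ^ n * w n)"
      by metis
    \<comment> \<open>All \<open>2 ^ n * w n\<close> are the same 2-adic integer, which is therefore
      divisible by every power of 2.\<close>
    have "2 ^ n dvd 2 ^ 0 * w 0" for n
      using w[of 0] w[of n] by (metis dvd_triv_left to_fract_eq_iff)
    then have "2 ^ 0 * w 0 = 0"
      by (rule two_adic_int_separated)
    then show ?thesis
      using w[of 0] D by auto
  qed
  then show ?thesis
    using V.sum_nonzero_representation_eq[OF V.independent_Basis, of x] V.span_Basis by auto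
qed

text \<open>The increments expand in the generators, and for each generator the coefficients
  \<open>2 ^ m * c m g\<close> sum to a 2-adic integer.\<close>

lemma finite_subring_complete:
  assumes S: "finite_subring S" and U0: "U 0 \<in> S"
    and U: "\<And>m. dvd_in S (2 ^ m) (U (Suc m) - U m)"
  obtains Y where "Y \<in> S" "\<And>m. dvd_in S (2 ^ m) (Y - U m)"
proof -
  interpret S: field_subring S
    using S by (rule finite_subring_field_subring)
  obtain G where G: "finite G" "S = M.span G"
    using S by (rule finite_subringE)
  have span: "S = range (\<lambda>u. \<Sum>g\<in>G. emb (u g) * g)"
    unfolding G(2) by (rule M.span_finite[OF G(1)])
  have "\<exists>c. U (Suc m) - U m = 2 ^ m * (\<Sum>g\<in>G. emb (c g) * g)" for m
    using U[of m] unfolding dvd_in_def span by auto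
  then obtain c where c: "\<And>m. U (Suc m) - U m = 2 ^ m * (\<Sum>g\<in>G. emb (c m g) * g)"
    by metis
  have "\<exists>A. \<forall>n. 2 ^ n dvd A - (\<Sum>i<n. 2 ^ i * c i g)" for g
    using two_adic_series_converges[of "\<lambda>i. c i g"] by metis
  then obtain A where A: "\<And>n g. 2 ^ n dvd A g - (\<Sum>i<n. 2 ^ i * c i g)"
    by metis
  define Y where "Y = U 0 + (\<Sum>g\<in>G. emb (A g) * g)"
  have "Y \<in> S"
    unfolding Y_def by (intro S.add_closed U0) (auto simp: span)
  moreover have "dvd_in S (2 ^ n) (Y - U n)" for n
  proof -
    obtain q where q: "\<And>g. A g - (\<Sum>i<n. 2 ^ i * c i g) = 2 ^ n * q g"
      using A[of n] unfolding dvd_def by metis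
    have "U n - U 0 = (\<Sum>i<n. 2 ^ i * (\<Sum>g\<in>G. emb (c i g) * g))"
      using sum_lessThan_telescope[of U n] by (simp add: c)
    also have "\<dots> = (\<Sum>i<n. \<Sum>g\<in>G. emb (2 ^ i * c i g) * g)"
      by (simp add: sum_distrib_left emb.hom_mult emb_power_2 mult.assoc)
    also have "\<dots> = (\<Sum>g\<in>G. emb (\<Sum>i<n. 2 ^ i * c i g) * g)"
      by (subst sum.swap) (simp add: emb.hom_sum sum_distrib_right)
    finally have "Y - U n = (\<Sum>g\<in>G. emb (A g - (\<Sum>i<n. 2 ^ i * c i g)) * g)"
      by (simp add: Y_def emb.hom_minus left_diff_distrib sum_subtractf algebra_simps)
    also have "\<dots> = 2 ^ n * (\<Sum>g\<in>G. emb (q g) * g)"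
      by (simp add: q emb.hom_mult emb_power_2 sum_distrib_left mult.assoc)
    finally show ?thesis
      unfolding dvd_in_def span by blast
  qed
  ultimately show thesis by (rule that)
qed

text \<open>The right-hand side is a contraction: its values differ by \<open>r\<close> times a
  multiple of the difference of the arguments, and some power of \<open>r\<close> is divisible by 2.
  This serves both for inverses and for roots of quadratics.\<close>

lemma finite_subring_fixpoint:
  assumes S: "finite_subring S" and rab: "r \<in> S" "a \<in> S" "b \<in> S"
    and k: "dvd_in S 2 (r ^ k)"
  obtains T where "T \<in> S" "T = 1 + r * (a * T + b * T\<^sup>2)"
proof -
  interpret S: field_subring S
    using S by (rule finite_subring_field_subring)
  define F where "F = (\<lambda>T. 1 + r * (a * T + b * T\<^sup>2))"
  define t where "t = (\<lambda>n. (F ^^ n) 1)"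
  have t_Suc: "t (Suc n) = F (t n)" for n
    by (simp add: t_def)
  have F_closed: "F x \<in> S" if "x \<in> S" for x
    unfolding F_def using that rab by (intro S.closed)
  have t_closed: "t n \<in> S" for n
    by (induction n) (auto simp: t_Suc F_closed, simp add: t_def S.one_closed)
  have F_diff: "F x - F y = (x - y) * r * (a + b * (x + y))" for x y
    by (simp add: F_def power2_eq_square algebra_simps)
  have step: "dvd_in S (r ^ n) (t (Suc n) - t n)" for n
  proof (induction n)
    case 0
    then show ?case
      using S.dvd_in_triv[OF S.diff_closed[OF t_closed t_closed], of 1 1 0] by simp
  next
    case (Suc n)
    then obtain s where s: "s \<in> S" "t (Suc n) - t n = r ^ n * s"
      by (auto simp: dvd_in_def)
    have "t (Suc (Suc n)) - t (Suc n) = F (t (Suc n)) - F (t n)"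
      by (simp add: t_Suc)
    also have "\<dots> = r ^ Suc n * (s * (a + b * (t (Suc n) + t n)))"
      unfolding F_diff s(2) by (simp add: mult_ac)
    finally show ?case
      using s(1) rab t_closed by (metis S.dvd_in_triv S.add_closed S.mult_closed)
  qed
  have steps: "dvd_in S (r ^ n) (t (n + j) - t n)" for n j
  proof (induction j)
    case (Suc j)
    have "dvd_in S (r ^ n) (r ^ (n + j))"
      using S.dvd_in_triv[OF S.power_closed[OF rab(1)]] by (simp add: power_add)
    then have "dvd_in S (r ^ n) (t (Suc (n + j)) - t (n + j))"
      using step S.dvd_in_trans by blast
    from S.dvd_in_add[OF this Suc] show ?case by simp
  qed (simp add: S.dvd_in_0)
  have two_r: "dvd_in S (2 ^ m) (r ^ (k * m))" for m
    using S.dvd_in_power[OF k, of m] by (simp add: power_mult)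
  \<comment> \<open>Each \<open>k\<close> iterations gain a factor 2, so the iterates at multiples
    of \<open>k\<close> converge.\<close>
  have "dvd_in S (2 ^ m) (t (k * Suc m) - t (k * m))" for m
    using S.dvd_in_trans[OF two_r steps[of "k * m" k]] by (simp add: add.commute)
  with S t_closed obtain Y where Y: "Y \<in> S" "\<And>m. dvd_in S (2 ^ m) (Y - t (k * m))"
    using finite_subring_complete[of S "\<lambda>m. t (k * m)"] by blast
  \<comment> \<open>Modulo \<open>2 ^ m\<close>, \<open>F Y\<close> agrees with the iterate after
    \<open>t (k * m)\<close>, hence with \<open>t (k * m)\<close> and with \<open>Y\<close>.\<close>
  have "dvd_in S (2 ^ m) (F Y - Y)" for m
  proof -
    have "dvd_in S (2 ^ m) (F Y - F (t (k * m)))"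
      unfolding F_diff using Y t_closed rab
      by (intro S.dvd_in_mult S.closed)
    moreover have "dvd_in S (2 ^ m) (F (t (k * m)) - t (k * m))"
      using S.dvd_in_trans[OF two_r step[of "k * m"]] by (simp add: t_Suc)
    ultimately show ?thesis
      using S.dvd_in_diff[OF S.dvd_in_add Y(2)[of m]] by fastforce
  qed
  then have "F Y - Y = 0"
    by (rule finite_subring_separated[OF S])
  then show thesis
    using Y(1) by (intro that[of Y]) (simp_all add: F_def)
qed

section \<open>Residues and powers modulo 2\<close>

text \<open>\<open>S\<close> modulo 2 is finite, since the coefficients modulo 2 at the finitely
  many generators determine a class.\<close>

lemma finite_subring_pigeonhole:
  assumes S: "finite_subring S" and f: "\<And>n :: nat. f n \<in> S"
  obtains i j where "i < j" "dvd_in S 2 (f i - f j)"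
proof -
  obtain G where G: "finite G" "S = M.span G"
    using S by (rule finite_subringE)
  have span: "S = range (\<lambda>u. \<Sum>g\<in>G. emb (u g) * g)"
    unfolding G(2) by (rule M.span_finite[OF G(1)])
  have "\<exists>c. f n = (\<Sum>g\<in>G. emb (c g) * g)" for n
    using f[of n] unfolding span by auto
  then obtain c where c: "\<And>n. f n = (\<Sum>g\<in>G. emb (c n g) * g)"
    by metis
  define \<phi> where "\<phi> = (\<lambda>n. \<lambda>g\<in>G. residue (c n g) 1)"
  have "residue x 1 \<in> {0..<2}" for x
    using residue_mod_self[of x 1] pos_mod_bound[of 2 "residue x 1"] pos_mod_sign[of 2 "residue x 1"]
    by simp
  then have "range \<phi> \<subseteq> PiE G (\<lambda>_. {0..<2})"
    by (auto simp: \<phi>_def)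
  then have "finite (range \<phi>)"
    by (rule finite_subset) (intro finite_PiE G(1), simp)
  then have "\<not> inj \<phi>"
    using finite_imageD infinite_UNIV_nat by blast
  then obtain i j where ij: "i < j" "\<phi> i = \<phi> j"
    by (metis injI nat_neq_iff)
  have "2 ^ 1 dvd c i g - c j g" if "g \<in> G" for g
    using that fun_cong[OF ij(2), of g] unfolding pow2_dvd_two_adic_int_iff
    by (simp add: \<phi>_def residue_simps)
  then have "\<forall>g\<in>G. \<exists>q. c i g - c j g = 2 * q"
    by (simp add: dvd_def)
  then obtain q where q: "\<And>g. g \<in> G \<Longrightarrow> c i g - c j g = 2 * q g"
    by metis
  have "f i - f j = (\<Sum>g\<in>G. emb (c i g - c j g) * g)"
    by (simp add: c emb.hom_minus left_diff_distrib sum_subtractf)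
  also have "\<dots> = 2 * (\<Sum>g\<in>G. emb (q g) * g)"
    by (simp add: q emb.hom_mult emb.hom_numeral sum_distrib_left mult.assoc)
  finally have "dvd_in S 2 (f i - f j)"
    unfolding dvd_in_def span by blast
  with ij(1) show thesis by (rule that)
qed

text \<open>The inverse is the fixed point of \<open>t = 1 - 2 * s * t\<close>, with contraction
  factor 2.\<close>

lemma finite_subring_one_plus_even_unit:
  assumes S: "finite_subring S" and s: "s \<in> S"
  obtains t where "t \<in> S" "t * (1 + 2 * s) = 1"
proof -
  interpret S: field_subring S
    using S by (rule finite_subring_field_subring)
  obtain t where "t \<in> S" "t = 1 + 2 * (- s * t + 0 * t\<^sup>2)"
    using finite_subring_fixpoint[OF S, of 2 "- s" 0 1] s S.closed S.dvd_in_refl by auto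
  then show thesis
    by (intro that[of t]) (simp_all add: algebra_simps)
qed

text \<open>An idempotent modulo 2 lifts to an idempotent of the domain \<open>S\<close>.\<close>
lemma finite_subring_idempotent_mod_2:
  assumes S: "finite_subring S" and f: "f \<in> S" "dvd_in S 2 (f\<^sup>2 - f)"
  shows "dvd_in S 2 f \<or> dvd_in S 2 (f - 1)"
proof -
  interpret S: field_subring S
    using S by (rule finite_subring_field_subring)
  obtain s where s: "s \<in> S" "f\<^sup>2 - f = 2 * s"
    using f(2) by (auto simp: dvd_in_def)
  \<comment> \<open>\<open>1 + 2 * (f - 1)\<close> is the derivative of \<open>y\<^sup>2 - y\<close>
    at \<open>f\<close>; \<open>v\<close> is its inverse.\<close>
  obtain v where v: "v \<in> S" "v * (1 + 2 * (f - 1)) = 1"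
    using finite_subring_one_plus_even_unit[OF S S.diff_closed[OF f(1) S.one_closed]] by blast
  \<comment> \<open>For \<open>y = f - 2 * v * s * T\<close>, the value \<open>y\<^sup>2 - y\<close>
    is \<open>2 * s\<close> times the defect of this equation, so its solution makes
    \<open>y\<close> idempotent.\<close>
  obtain T where T: "T \<in> S" "T = 1 + 2 * (0 * T + v\<^sup>2 * s * T\<^sup>2)"
    using finite_subring_fixpoint[OF S, of 2 0 "v\<^sup>2 * s" 1] s v S.closed S.dvd_in_refl by auto
  define q where "q = v * s * T"
  have q: "q \<in> S"
    using s v T by (simp add: q_def S.closed)
  have "(f - 2 * q)\<^sup>2 - (f - 2 * q)
      = (f\<^sup>2 - f) - 2 * s * T * (v * (1 + 2 * (f - 1))) + 4 * v\<^sup>2 * s\<^sup>2 * T\<^sup>2"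
    by (simp add: q_def power2_eq_square algebra_simps)
  also have "\<dots> = 2 * s * (1 + 2 * (0 * T + v\<^sup>2 * s * T\<^sup>2) - T)"
    unfolding s(2) v(2) by (simp add: power2_eq_square algebra_simps)
  also have "\<dots> = 0"
    using T(2) by simp
  finally have "(f - 2 * q) * (f - 2 * q - 1) = 0"
    by (simp add: power2_eq_square algebra_simps)
  then have "f - 2 * q = 0 \<or> f - 2 * q - 1 = 0"
    by (simp only: mult_eq_0_iff)
  then have "f = 2 * q \<or> f - 1 = 2 * q"
    by (auto simp: diff_eq_eq)
  then show ?thesis
    using q by (auto simp: dvd_in_def)
qed

text \<open>The powers of \<open>x\<close> are eventually periodic modulo 2, so one of them is
  idempotent modulo 2 and hence congruent to 0 or 1.\<close>

lemma finite_subring_power_mod_2: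
  assumes S: "finite_subring S" and x: "x \<in> S"
  obtains k where "k > 0" "dvd_in S 2 (x ^ k) \<or> dvd_in S 2 (x ^ k - 1)"
proof -
  interpret S: field_subring S
    using S by (rule finite_subring_field_subring)
  obtain i j where ij: "i < j" "dvd_in S 2 (x ^ i - x ^ j)"
    using finite_subring_pigeonhole[OF S, of "\<lambda>n. x ^ n"] S.power_closed[OF x] by blast
  define d where "d = j - i"
  have j: "j = i + d"
    using ij(1) by (simp add: d_def)
  have per: "dvd_in S 2 (x ^ m - x ^ (m + d * q))" if "m \<ge> i" for m q
  proof (induction q)
    case (Suc q)
    have "dvd_in S 2 (x ^ (m + d * q - i) * (x ^ i - x ^ j))"
      using ij x by (intro S.dvd_in_mult_left S.power_closed)
    also have "x ^ (m + d * q - i) * (x ^ i - x ^ j) = x ^ (m + d * q) - x ^ (m + d * Suc q)"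
    proof -
      have "m + d * q - i + i = m + d * q" "m + d * q - i + j = m + d * Suc q"
        using that j by simp_all
      then show ?thesis
        by (simp only: right_diff_distrib flip: power_add)
    qed
    finally show ?case
      using S.dvd_in_add[OF Suc] by fastforce
  qed (simp add: S.dvd_in_0)
  \<comment> \<open>A multiple of the period \<open>d\<close> that is positive and at least
    \<open>i\<close>, so that \<open>x ^ k\<close> and \<open>x ^ (2 * k)\<close> agree modulo
    2.\<close>
  define k where "k = d * Suc i"
  have d: "d > 0" using ij(1) by (simp add: d_def)
  then have "k \<ge> i" "k > 0"
    by (auto simp: k_def trans_le_add2)
  have "dvd_in S 2 (x ^ k - (x ^ k)\<^sup>2)"
    using per[OF \<open>k \<ge> i\<close>, of "Suc i"] by (simp add: k_def power2_eq_square power_add)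
  from S.dvd_in_diff[OF S.dvd_in_0 this] have "dvd_in S 2 (x ^ k) \<or> dvd_in S 2 (x ^ k - 1)"
    using S x by (intro finite_subring_idempotent_mod_2 S.power_closed) simp_all
  with \<open>k > 0\<close> show thesis by (rule that)
qed

section \<open>The ring of integers\<close>

abbreviation "\<O> \<equiv> ring_of_integers \<iota>"

lemma finite_subring_subset: "finite_subring S \<Longrightarrow> S \<subseteq> \<O>"
  using finite_subring_integral by blast

text \<open>This moves statements about integral elements into a ring where completeness is
  available.\<close>

lemma finite_subring_containing:
  assumes "x \<in> \<O>" "y \<in> \<O>"
  obtains S where "finite_subring S" "x \<in> S" "y \<in> S"
proof -
  obtain S where S: "finite_subring S" "x \<in> S"
    using finite_subring_adjoin[OF finite_subring_range assms(1)] .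
  obtain S' where "finite_subring S'" "S \<subseteq> S'" "y \<in> S'"
    using finite_subring_adjoin[OF S(1) assms(2)] .
  with S(2) show thesis by (intro that) auto
qed

sublocale O: field_subring \<O>
proof
  show "1 \<in> \<O>"
    using finite_subring_subset[OF finite_subring_range] by (auto intro: range_eqI[of _ _ 1])
  fix x y assume xy: "x \<in> \<O>" "y \<in> \<O>"
  obtain S where S: "finite_subring S" "x \<in> S" "y \<in> S"
    using finite_subring_containing[OF xy] .
  interpret S: field_subring S
    using S(1) by (rule finite_subring_field_subring)
  show "x - y \<in> \<O>" "x * y \<in> \<O>"
    using S finite_subring_subset[OF S(1)] S.closed by auto
qed

lemma dvd_in_finite_subring: "finite_subring S \<Longrightarrow> dvd_in S a b \<Longrightarrow> dvd_in \<O> a b"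
  using finite_subring_subset unfolding dvd_in_def by blast

lemma two_neq_0: "(2 :: 'k) \<noteq> 0"
  using two_neq_0_two_adic_int emb.hom_0_iff[of 2] by (simp add: emb.hom_numeral)

text \<open>If 1/2 were integral, \<open>1\<close> would be divisible by all powers of 2 in a
  finitely generated subring, against separation.\<close>

lemma not_dvd_in_2_1: "\<not> dvd_in \<O> 2 1"
proof
  assume "dvd_in \<O> 2 1"
  then obtain x where x: "x \<in> \<O>" "1 = 2 * x"
    by (auto simp: dvd_in_def)
  obtain S where S: "finite_subring S" "x \<in> S"
    using finite_subring_containing[OF x(1) x(1)] .
  interpret S: field_subring S
    using S(1) by (rule finite_subring_field_subring)
  have "1 = 2 ^ n * x ^ n" for n
    using x(2) by (simp flip: power_mult_distrib)
  then have "dvd_in S (2 ^ n) 1" for n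
    using S.power_closed[OF S(2)] unfolding dvd_in_def by blast
  then have "(1 :: 'k) = 0"
    by (rule finite_subring_separated[OF S(1)])
  then show False by simp
qed

text \<open>Some positive power of \<open>x\<close> is 0 or 1 modulo 2; in the latter case that
  power is invertible, and so is \<open>x\<close>.\<close>

lemma unit_or_dvd_in_power:
  assumes x: "x \<in> \<O>" "x \<notin> units_in \<O>"
  obtains k where "dvd_in \<O> 2 (x ^ k)"
proof -
  obtain S where S: "finite_subring S" "x \<in> S"
    using finite_subring_containing[OF x(1) x(1)] .
  interpret S: field_subring S
    using S(1) by (rule finite_subring_field_subring)
  obtain k where k: "k > 0" "dvd_in S 2 (x ^ k) \<or> dvd_in S 2 (x ^ k - 1)"
    using finite_subring_power_mod_2[OF S] .
  have "\<not> dvd_in S 2 (x ^ k - 1)"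
  proof
    assume "dvd_in S 2 (x ^ k - 1)"
    then obtain s where s: "s \<in> S" "x ^ k = 1 + 2 * s"
      by (auto simp: dvd_in_def algebra_simps)
    obtain t where t: "t \<in> S" "t * x ^ k = 1"
      using finite_subring_one_plus_even_unit[OF S(1) s(1)] s(2) by metis
    have "1 = x * (t * x ^ (k - 1))"
      using t(2) k(1) by (cases k) (simp_all add: mult_ac)
    moreover have "t * x ^ (k - 1) \<in> S"
      using t S by (intro S.closed)
    ultimately have "dvd_in \<O> x 1"
      using dvd_in_finite_subring[OF S(1)] unfolding dvd_in_def by blast
    then show False
      using x by (simp add: units_in_def)
  qed
  with k S show thesis
    using dvd_in_finite_subring that by blast
qed

end

section \<open>Binary quadratic forms and the Hilbert symbol\<close>

text \<open>An isotropic form is a hyperbolic plane: it factors as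
  \<open>b * (q - c * p) * (q + c * p)\<close>.\<close>

lemma binary_isotropic_universal:
  fixes a b x y :: "'a :: field"
  assumes "(2 :: 'a) \<noteq> 0" "a \<noteq> 0" "b \<noteq> 0" "x \<noteq> 0" "a * x\<^sup>2 + b * y\<^sup>2 = 0"
  shows "\<exists>x y. a * x\<^sup>2 + b * y\<^sup>2 = 1"
proof -
  define c where "c = y / x"
  have a: "a = - b * c\<^sup>2"
    using assms by (simp add: c_def power_divide field_simps add_eq_0_iff)
  then have c: "c \<noteq> 0"
    using assms(2) by auto
  \<comment> \<open>\<open>p\<close> and \<open>q\<close> solve the linear system
    \<open>q - c * p = 1\<close>, \<open>q + c * p = 1 / b\<close>.\<close>
  define p where "p = (1 / b - 1) / (2 * c)"
  define q where "q = (1 / b + 1) / 2"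
  have cp: "c * p = (1 / b - 1) / 2"
    using c by (simp add: p_def)
  have "a * p\<^sup>2 + b * q\<^sup>2 = b * ((q - c * p) * (q + c * p))"
    by (simp add: a power2_eq_square algebra_simps)
  also have "q - c * p = 1"
  proof -
    have "q - c * p = ((1 / b + 1) - (1 / b - 1)) / 2"
      by (simp only: cp q_def diff_divide_distrib)
    then show ?thesis using assms(1) by simp
  qed
  also have "q + c * p = 1 / b"
  proof -
    have "q + c * p = ((1 / b + 1) + (1 / b - 1)) / 2"
      by (simp only: cp q_def add_divide_distrib)
    also have "(1 / b + 1) + (1 / b - 1) = 2 * (1 / b)"
      by simp
    finally show ?thesis using assms(1) by simp
  qed
  finally show ?thesis
    using assms(3) by auto
qed

text \<open>For nonzero \<open>z\<close> one divides by \<open>z\<^sup>2\<close>; for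
  \<open>z = 0\<close> the condition on \<open>x\<close> makes the form isotropic.\<close>

lemma hilbert_symbol_eq_1I:
  fixes a b x y z :: "'a :: field"
  assumes "(2 :: 'a) \<noteq> 0" "a \<noteq> 0" "b \<noteq> 0" "x \<noteq> 0" "a * x\<^sup>2 + b * y\<^sup>2 = z\<^sup>2"
  shows "hilbert_symbol a b = 1"
proof -
  have "\<exists>x y. a * x\<^sup>2 + b * y\<^sup>2 = 1"
  proof (cases "z = 0")
    case True
    then show ?thesis
      using assms binary_isotropic_universal by auto
  next
    case False
    then have "a * (x / z)\<^sup>2 + b * (y / z)\<^sup>2 = 1"
      using assms(5) by (simp add: power_divide flip: add_divide_distrib)
    then show ?thesis by blast
  qed
  then show ?thesis
    by (simp add: hilbert_symbol_def)
qed

lemma hilbert_symbol_commute: "hilbert_symbol a b = hilbert_symbol b a"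
  unfolding hilbert_symbol_def by (metis add.commute)

section \<open>Prime elements, units and residues of the ring of integers\<close>

locale two_adic_extension_prime = two_adic_extension \<iota>
  for \<iota> :: "two_adic \<Rightarrow> 'k :: field" +
  fixes \<pi> :: 'k
  assumes prime: "prime_elem_in \<O> \<pi>"
begin

abbreviation pi_dvd :: "'k \<Rightarrow> bool" where
  "pi_dvd \<equiv> dvd_in \<O> \<pi>"

lemma pi_in: "\<pi> \<in> \<O>" and pi_neq_0: "\<pi> \<noteq> 0" and pi_not_unit: "\<pi> \<notin> units_in \<O>"
  and pi_dvd_multD: "a \<in> \<O> \<Longrightarrow> b \<in> \<O> \<Longrightarrow> pi_dvd (a * b) \<Longrightarrow> pi_dvd a \<or> pi_dvd b"
  using prime by (auto simp: prime_elem_in_def)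

lemma unit_not_pi_dvd: "u \<in> units_in \<O> \<Longrightarrow> \<not> pi_dvd u"
  using pi_not_unit pi_in O.dvd_in_trans by (auto simp: units_in_def)

lemma not_pi_dvd_1: "\<not> pi_dvd 1"
  using pi_not_unit pi_in by (auto simp: units_in_def)

lemma pi_dvd_powerD: "x \<in> \<O> \<Longrightarrow> pi_dvd (x ^ n) \<Longrightarrow> pi_dvd x"
  by (induction n) (use not_pi_dvd_1 pi_dvd_multD O.power_closed in auto)

text \<open>2 divides a power of the nonunit \<pi>. If \<pi> did not divide 2, primality would let
  the factors \<pi> be cancelled one by one until 2 divides 1.\<close>

lemma pi_dvd_2: "pi_dvd 2"
proof (rule ccontr)
  assume not: "\<not> pi_dvd 2"
  obtain k where "dvd_in \<O> 2 (\<pi> ^ k)"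
    using unit_or_dvd_in_power[OF pi_in pi_not_unit] .
  then show False
  proof (induction k)
    case 0
    then show ?case using not_dvd_in_2_1 by simp
  next
    case (Suc k)
    then obtain s where s: "s \<in> \<O>" "\<pi> * \<pi> ^ k = 2 * s"
      by (auto simp: dvd_in_def)
    then have "pi_dvd (2 * s)"
      using O.dvd_in_triv[OF O.power_closed[OF pi_in]] by metis
    then have "pi_dvd s"
      using pi_dvd_multD s(1) O.numeral_closed not by blast
    then obtain s' where "s' \<in> \<O>" "s = \<pi> * s'"
      by (auto simp: dvd_in_def)
    then have "\<pi> ^ k = 2 * s'" "s' \<in> \<O>"
      using s(2) pi_neq_0 by (simp_all add: mult.left_commute[of 2])
    then show ?case
      using Suc.IH by (auto simp: dvd_in_def)
  qed
qed

text \<open>A nonunit has a power divisible by 2, hence by \<pi>, and primality passes this to the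
  nonunit itself.\<close>

lemma unit_iff_not_pi_dvd:
  assumes "x \<in> \<O>"
  shows "x \<in> units_in \<O> \<longleftrightarrow> \<not> pi_dvd x"
proof
  assume *: "\<not> pi_dvd x"
  show "x \<in> units_in \<O>"
  proof (rule ccontr)
    assume "x \<notin> units_in \<O>"
    then obtain k where "dvd_in \<O> 2 (x ^ k)"
      using unit_or_dvd_in_power assms by blast
    then show False
      using * O.dvd_in_trans[OF pi_dvd_2] pi_dvd_powerD[OF assms] by blast
  qed
qed (rule unit_not_pi_dvd)

text \<open>The powers \<open>\<alpha> ^ 2 ^ n\<close> take finitely many values modulo 2, and squaring is injective
  modulo \<open>\<pi>\<close>, so \<open>\<alpha>\<close> is congruent to one of them with \<open>n > 0\<close>.\<close>
lemma square_root_mod_pi: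
  assumes \<alpha>: "\<alpha> \<in> \<O>"
  obtains w where "w \<in> \<O>" "pi_dvd (w\<^sup>2 - \<alpha>)"
proof -
  obtain S where S: "finite_subring S" "\<alpha> \<in> S"
    using finite_subring_containing[OF \<alpha> \<alpha>] .
  interpret S: field_subring S
    using S(1) by (rule finite_subring_field_subring)
  obtain i j where ij: "i < j" "dvd_in S 2 (\<alpha> ^ 2 ^ i - \<alpha> ^ 2 ^ j)"
    using finite_subring_pigeonhole[OF S(1), of "\<lambda>n. \<alpha> ^ 2 ^ n"] S.power_closed[OF S(2)] by blast
  \<comment> \<open>Modulo 2, and so modulo \<pi>, a difference of squares is the square of the
    difference.\<close>
  have sq: "pi_dvd (x - y)" if xy: "x \<in> \<O>" "y \<in> \<O>" and d: "pi_dvd (x\<^sup>2 - y\<^sup>2)" for x y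
  proof -
    have "pi_dvd (x\<^sup>2 - y\<^sup>2 - 2 * (y * (x - y)))"
      using xy by (intro O.dvd_in_diff[OF d] O.dvd_in_mult[OF pi_dvd_2] O.closed)
    also have "x\<^sup>2 - y\<^sup>2 - 2 * (y * (x - y)) = (x - y)\<^sup>2"
      by (simp add: power2_eq_square algebra_simps)
    finally show ?thesis
      using pi_dvd_powerD[OF O.diff_closed[OF xy]] by blast
  qed
  have square: "\<alpha> ^ 2 ^ Suc n = (\<alpha> ^ 2 ^ n)\<^sup>2" for n
    by (simp only: power_Suc2 power_mult)
  have "pi_dvd (\<alpha> - \<alpha> ^ 2 ^ n)" if "pi_dvd (\<alpha> ^ 2 ^ m - \<alpha> ^ 2 ^ (m + n))" for m n
    using that
  proof (induction m)
    case (Suc m)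
    then have "pi_dvd ((\<alpha> ^ 2 ^ m)\<^sup>2 - (\<alpha> ^ 2 ^ (m + n))\<^sup>2)"
      by (simp only: add_Suc square)
    then show ?case
      by (intro Suc.IH sq[OF O.power_closed[OF \<alpha>] O.power_closed[OF \<alpha>]])
  qed simp
  from this[of i "j - i"] have "pi_dvd (\<alpha> - \<alpha> ^ 2 ^ (j - i))"
    using ij O.dvd_in_trans[OF pi_dvd_2 dvd_in_finite_subring[OF S(1) ij(2)]] by simp
  then have "pi_dvd (0 - (\<alpha> - \<alpha> ^ 2 ^ (j - i)))"
    using O.dvd_in_diff[OF O.dvd_in_0] by blast
  \<comment> \<open>Since \<open>j - i\<close> is positive, the power of \<alpha> is a square, with
    root \<open>\<alpha> ^ 2 ^ d\<close>.\<close>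
  moreover obtain d where "j - i = Suc d"
    using ij(1) by (metis Suc_diff_Suc)
  ultimately have "pi_dvd ((\<alpha> ^ 2 ^ d)\<^sup>2 - \<alpha>)"
    by (simp only: square diff_0 minus_diff_eq)
  then show thesis
    by (rule that[OF O.power_closed[OF \<alpha>]])
qed

text \<open>By maximality of the exponent the cofactor \<epsilon> is not divisible by \<pi>, so it
  is a unit.\<close>

lemma ramification_index:
  obtains \<epsilon> where "\<epsilon> \<in> units_in \<O>" "2 = \<pi> ^ ramification_index \<iota> \<pi> * \<epsilon>"
    "ramification_index \<iota> \<pi> > 0"
proof -
  let ?P = "\<lambda>n. dvd_in \<O> (\<pi> ^ n) 2"
  let ?e = "ramification_index \<iota> \<pi>"
  obtain k where k: "dvd_in \<O> 2 (\<pi> ^ k)"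
    using unit_or_dvd_in_power[OF pi_in pi_not_unit] .
  \<comment> \<open>\<open>GREATEST\<close> needs a bound: 2 divides \<open>\<pi> ^ k\<close>, so if
    \<open>\<pi> ^ (k + k)\<close> divided 2, then 4 would divide 2.\<close>
  have bound: "n \<le> k + k" if "?P n" for n
  proof (rule ccontr)
    assume "\<not> n \<le> k + k"
    then have "\<pi> ^ n = \<pi> ^ k * \<pi> ^ k * \<pi> ^ (n - (k + k))"
      by (simp flip: power_add)
    then have "dvd_in \<O> (\<pi> ^ k * \<pi> ^ k) (\<pi> ^ n)"
      using O.dvd_in_triv O.power_closed[OF pi_in] by metis
    from O.dvd_in_trans[OF this that]
    obtain c where c: "c \<in> \<O>" "2 = \<pi> ^ k * \<pi> ^ k * c"
      by (auto simp: dvd_in_def)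
    obtain s where s: "s \<in> \<O>" "\<pi> ^ k = 2 * s"
      using k by (auto simp: dvd_in_def)
    have "2 * 1 = 2 * (2 * (s * s * c))"
      using c(2) unfolding s(2) by (simp add: mult_ac)
    then have "1 = 2 * (s * s * c)"
      using two_neq_0 mult_left_cancel by blast
    then have "dvd_in \<O> 2 1"
      using s(1) c(1) O.mult_closed unfolding dvd_in_def by blast
    then show False
      using not_dvd_in_2_1 by simp
  qed
  have e: "?P ?e"
    unfolding ramification_index_def
    using pi_dvd_2 bound by (intro GreatestI_nat[of ?P 1 "k + k"]) auto
  have max: "n \<le> ?e" if "?P n" for n
    unfolding ramification_index_def
    using that bound by (intro Greatest_le_nat[of ?P n "k + k"]) auto
  obtain \<epsilon> where \<epsilon>: "\<epsilon> \<in> \<O>" "2 = \<pi> ^ ?e * \<epsilon>"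
    using e by (auto simp: dvd_in_def)
  have "\<not> pi_dvd \<epsilon>"
  proof
    assume "pi_dvd \<epsilon>"
    then have "?P (Suc ?e)"
      using \<epsilon>(2) unfolding dvd_in_def by (metis mult.assoc power_Suc2)
    then show False
      using max[of "Suc ?e"] by simp
  qed
  then show thesis
    using \<epsilon> max[of 1] pi_dvd_2 unit_iff_not_pi_dvd by (intro that) auto
qed

text \<open>Hensel's lemma: with \<open>Y = c * T / u\<close> the equation becomes a fixed point equation for \<open>T\<close>.\<close>
lemma quadratic_root:
  assumes u: "u \<in> units_in \<O>" and b: "b \<in> \<O>" and c: "c \<in> \<O>" "pi_dvd c"
  obtains Y where "b * Y\<^sup>2 - u * Y + c = 0"
proof -
  define r where "r = c * (b * (inverse u)\<^sup>2)"
  have u': "u \<noteq> 0" "inverse u \<in> \<O>"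
    using u by (auto simp: O.units_in_iff)
  then have "pi_dvd r" and r: "r \<in> \<O>"
    unfolding r_def using b c by (auto intro!: O.dvd_in_mult O.closed)
  then have "r \<notin> units_in \<O>"
    using unit_not_pi_dvd by blast
  then obtain k where "dvd_in \<O> 2 (r ^ k)"
    using unit_or_dvd_in_power r by blast
  then obtain q where q: "q \<in> \<O>" "r ^ k = 2 * q"
    by (auto simp: dvd_in_def)
  \<comment> \<open>The cofactor \<open>q\<close> is put into \<open>S\<close> so that
    \<open>r ^ k\<close> is divisible by 2 inside \<open>S\<close>.\<close>
  obtain S where S: "finite_subring S" "r \<in> S" "q \<in> S"
    using finite_subring_containing[OF r q(1)] .
  interpret S: field_subring S
    using S(1) by (rule finite_subring_field_subring)
  have "dvd_in S 2 (r ^ k)"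
    using S(3) q(2) by (auto simp: dvd_in_def)
  then obtain T where T: "T = 1 + r * (0 * T + 1 * T\<^sup>2)"
    using finite_subring_fixpoint[OF S(1,2) S.zero_closed S.one_closed] by blast
  define Y where "Y = c * inverse u * T"
  have "b * Y\<^sup>2 - u * Y + c = c * (1 + r * (0 * T + 1 * T\<^sup>2) - T)"
    using u'(1) by (simp add: Y_def r_def power2_eq_square algebra_simps)
  then show thesis
    using T by (intro that[of Y]) simp
qed

text \<open>Brings level 0 into the same form as the higher levels, with \<alpha> equal to
  \<open>a - 1\<close>. At positive level \<open>a\<close> is 1 modulo \<pi>, hence a unit.\<close>

lemma unit_groupE:
  assumes "a \<in> unit_group \<iota> \<pi> n"
  obtains \<alpha> where "\<alpha> \<in> \<O>" "a = 1 + \<pi> ^ n * \<alpha>" "a \<in> units_in \<O>"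
proof (cases "n = 0")
  case True
  then have "a \<in> units_in \<O>"
    using assms by (simp add: unit_group_def)
  then show thesis
    using True O.diff_closed[OF _ O.one_closed, of a]
    by (intro that[of "a - 1"]) (auto simp: units_in_def)
next
  case False
  then obtain \<alpha> where \<alpha>: "\<alpha> \<in> \<O>" "a = 1 + \<pi> ^ n * \<alpha>"
    using assms by (auto simp: unit_group_def)
  have pn: "pi_dvd (\<pi> ^ n * \<alpha>)"
    using False \<alpha>(1) O.dvd_in_triv[of "\<pi> ^ (n - 1) * \<alpha>" \<pi>] O.closed pi_in
    by (cases n) (simp_all add: mult.assoc)
  have "\<not> pi_dvd a"
    using O.dvd_in_diff[OF _ pn, of a] not_pi_dvd_1 \<alpha>(2) by auto
  then show thesis
    using \<alpha> O.closed pi_in by (intro that[of \<alpha>]) (simp_all add: unit_iff_not_pi_dvd)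
qed

text \<open>Positivity of \<open>t\<close> makes \<open>q\<close> divisible by \<pi>, as the
  constant coefficient requires; \<open>s\<close> may be 0.\<close>

lemma hilbert_symbol_unit_groups:
  assumes a: "a \<in> unit_group \<iota> \<pi> (2 * s)" and b: "b \<in> unit_group \<iota> \<pi> (2 * t)"
    and st: "s + t = ramification_index \<iota> \<pi>" and t: "t > 0"
  shows "hilbert_symbol a b = 1"
proof -
  obtain \<alpha> where \<alpha>: "\<alpha> \<in> \<O>" "a = 1 + \<pi> ^ (2 * s) * \<alpha>" "a \<in> units_in \<O>"
    using a by (rule unit_groupE)
  obtain \<beta> where \<beta>: "\<beta> \<in> \<O>" "b = 1 + \<pi> ^ (2 * t) * \<beta>" "b \<in> units_in \<O>"
    using b by (rule unit_groupE)
  obtain \<epsilon> where \<epsilon>: "\<epsilon> \<in> units_in \<O>" "2 = \<pi> ^ ramification_index \<iota> \<pi> * \<epsilon>"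
    using ramification_index .
  define p q where "p = \<pi> ^ s" and "q = \<pi> ^ t"
  have "q = \<pi> * \<pi> ^ (t - 1)"
    using t by (cases t) (simp_all add: q_def)
  then have "pi_dvd q"
    using O.dvd_in_triv[OF O.power_closed[OF pi_in]] by simp
  then have pq: "p \<in> \<O>" "q \<in> \<O>" "p \<noteq> 0" "q \<noteq> 0" "pi_dvd q"
    using pi_in pi_neq_0 by (simp_all add: p_def q_def O.power_closed)
  have \<epsilon>_in: "\<epsilon> \<in> \<O>" and two: "2 = p * q * \<epsilon>"
    using \<epsilon> by (simp_all add: O.units_in_iff p_def q_def flip: power_add st)
  have ab: "a = 1 + p\<^sup>2 * \<alpha>" "b = 1 + q\<^sup>2 * \<beta>"
    using \<alpha>(2) \<beta>(2) by (simp_all add: p_def q_def mult.commute[of 2] power_mult)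
  obtain w where w: "w \<in> \<O>" "pi_dvd (w\<^sup>2 - \<alpha>)"
    using square_root_mod_pi[OF \<alpha>(1)] .
  have "1 + p * w \<in> units_in \<O>"
  proof -
    have "\<not> pi_dvd (1 + p * w)"
    proof
      assume "pi_dvd (1 + p * w)"
      then have "pi_dvd ((1 + p * w) * (1 + p * w))" "pi_dvd (2 * (p * w))"
        "pi_dvd ((w\<^sup>2 - \<alpha>) * p\<^sup>2)"
        using pq w by (auto intro!: O.dvd_in_mult[OF pi_dvd_2] O.dvd_in_mult O.closed)
      \<comment> \<open>This combination equals \<open>a\<close>, so \<pi> would divide a
        unit.\<close>
      then have "pi_dvd ((1 + p * w) * (1 + p * w) - 2 * (p * w) - (w\<^sup>2 - \<alpha>) * p\<^sup>2)"
        by (intro O.dvd_in_diff)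
      also have "(1 + p * w) * (1 + p * w) - 2 * (p * w) - (w\<^sup>2 - \<alpha>) * p\<^sup>2 = a"
        by (simp add: ab power2_eq_square algebra_simps)
      finally show False
        using \<alpha>(3) unit_not_pi_dvd by blast
    qed
    then show ?thesis
      using pq w by (simp add: unit_iff_not_pi_dvd O.closed)
  qed
  then have u: "\<epsilon> * (1 + p * w) \<in> units_in \<O>"
    using \<epsilon>(1) by (auto simp: O.units_in_iff O.mult_closed)
  define c where "c = \<alpha> - w\<^sup>2 - \<epsilon> * q * w"
  have c: "c \<in> \<O>"
    unfolding c_def using \<alpha>(1) w(1) \<epsilon>_in pq by (intro O.closed)
  have "pi_dvd (0 - (w\<^sup>2 - \<alpha>) - q * (\<epsilon> * w))"
    using w(1) pq(5) \<epsilon>_in by (intro O.dvd_in_diff[OF O.dvd_in_diff[OF O.dvd_in_0 w(2)]] O.dvd_in_mult O.closed)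
  then have "pi_dvd c"
    by (simp add: c_def algebra_simps)
  from quadratic_root[OF u \<beta>(1) c this]
  obtain Y where Y: "\<beta> * Y\<^sup>2 - \<epsilon> * (1 + p * w) * Y + c = 0" .
  \<comment> \<open>The rational solution multiplied by \<open>p * q\<close>, which clears the
    denominators.\<close>
  define z where "z = q + p * Y + p * q * w"
  have "z\<^sup>2 = q\<^sup>2 + p\<^sup>2 * Y\<^sup>2 + p\<^sup>2 * q\<^sup>2 * w\<^sup>2 + 2 * (p * q * Y + p * q\<^sup>2 * w + p\<^sup>2 * q * w * Y)"
    by (simp add: z_def power2_eq_square algebra_simps)
  \<comment> \<open>The factor 2 of the cross terms becomes \<open>p * q * \<epsilon>\<close>, which
    makes the quadratic in \<open>Y\<close> appear with factor
    \<open>p\<^sup>2 * q\<^sup>2\<close>.\<close>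
  also have "\<dots> = a * q\<^sup>2 + b * (p * Y)\<^sup>2 - p\<^sup>2 * q\<^sup>2 * (\<beta> * Y\<^sup>2 - \<epsilon> * (1 + p * w) * Y + c)"
    unfolding two by (simp add: ab c_def power2_eq_square algebra_simps)
  finally have "a * q\<^sup>2 + b * (p * Y)\<^sup>2 = z\<^sup>2"
    unfolding Y by simp
  then show ?thesis
    using hilbert_symbol_eq_1I[OF two_neq_0] \<alpha>(3) \<beta>(3) pq(4) by (auto simp: O.units_in_iff)
qed

end

theorem proposition21:
  fixes \<iota> :: "two_adic \<Rightarrow> 'k :: field"
    and \<pi> :: 'k
    and i j :: nat
  assumes "finite_field_extension \<iota>"
    and "prime_elem_in (ring_of_integers \<iota>) \<pi>"
    and "even i" and "even j"
    and "i + j = 2 * ramification_index \<iota> \<pi>"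
  shows "\<forall>a \<in> unit_group \<iota> \<pi> i. \<forall>b \<in> unit_group \<iota> \<pi> j. hilbert_symbol a b = 1"
proof -
  interpret two_adic_extension_prime \<iota> \<pi>
    using assms by unfold_locales
  obtain s t where st: "i = 2 * s" "j = 2 * t"
    using assms(3,4) by (auto elim!: evenE)
  have sum: "s + t = ramification_index \<iota> \<pi>" "t + s = ramification_index \<iota> \<pi>"
    using assms(5) by (simp_all add: st)
  have "ramification_index \<iota> \<pi> > 0"
    using ramification_index by blast
  \<comment> \<open>As the index is positive, one of the halves is; symmetry of the symbol exchanges
    the two cases.\<close>
  then have "t > 0 \<or> s > 0"
    using sum(1) by linarith
  then show ?thesis
    unfolding st
  proof (elim disjE, goal_cases)
    case 1
    then show ?case
      using hilbert_symbol_unit_groups[OF _ _ sum(1)] by blast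
  next
    case 2
    then show ?case
      using hilbert_symbol_unit_groups[OF _ _ sum(2)] by (subst hilbert_symbol_commute) blast
  qed
qed

end
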